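(* Let $D\subset\mathbb{R}^m$ and $E\subset\mathbb{R}^r$ be compact sets with Lipschitz boundaries and let $\delta>0$. For any $p\in\mathcal{X}_\delta$ and $q\in\mathcal{X}_\delta$, $$\|\mathcal{G}^\star(p)-\mathcal{G}^\star(q)\|_{C(D\times E)}\le\frac1\delta\Bigl(1+\frac{|D|\min\bigl(\|p\|_{C(D\times E)},\|q\|_{C(D\times E)}\bigr)}{\delta}\Bigr)\|p-q\|_{C(D\times E)} .$$
   Context: $C(D\times E)$ carries the supremum norm; $|D|$ is the Lebesgue measure of $D$. $C_{\mathrm{ac}}(D\times E)$ is the set of $\rho\in C(D\times E)$ with $\rho\ge0$ and $\int_{D\times E}\rho(z)\,dz=1$. For such $\rho$, $m_\rho(y)=\int_D\rho(x,y)\,dx$ for $y\in E$. $\mathcal{X}_\delta=\{\rho\in C_{\mathrm{ac}}(D\times E):\inf_{y\in E}m_\rho(y)\ge\delta\}$. The kernel conditioning operator is $\mathcal{G}^\star:\mathcal{X}_\delta\to C(D\times E)$, $\mathcal{G}^\star(\rho)(x,y)=\rho(x,y)/m_\rho(y)$. *)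

theory Defs
  imports "HOL-Analysis.Analysis"
begin

(* Elements of C(K) are total functions f with continuous_on K f; every notion below depends
   only on the restriction of f to K. *)

definition sup_norm_on :: "'a set \<Rightarrow> ('a \<Rightarrow> real) \<Rightarrow> real" where
  "sup_norm_on K f = (SUP z\<in>K. \<bar>f z\<bar>)"

(* Near each boundary point x, after an orthogonal change of coordinates whose last axis is e,
   the set S is the (closed) epigraph of a Lipschitz function g defined on the hyperplane
   orthogonal to e. Intended for closed S. In dimension one the hyperplane is {0}. *)
definition lipschitz_boundary :: "'a::euclidean_space set \<Rightarrow> bool" where
  "lipschitz_boundary S \<longleftrightarrow>
     (\<forall>x\<in>frontier S. \<exists>(e::'a) (r::real) (L::real) (g::'a \<Rightarrow> real).
        norm e = 1 \<and> r > 0 \<and> L-lipschitz_on {v. v \<bullet> e = 0} g \<and>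
        S \<inter> ball x r = {y \<in> ball x r. g (y - (y \<bullet> e) *\<^sub>R e) \<le> y \<bullet> e})"

definition C_ac :: "'a::euclidean_space set \<Rightarrow> ('a \<Rightarrow> real) set" where
  "C_ac K = {\<rho>. continuous_on K \<rho> \<and> (\<forall>z\<in>K. 0 \<le> \<rho> z) \<and> (LINT z:K|lborel. \<rho> z) = 1}"

definition marginal ::
  "'a::euclidean_space set \<Rightarrow> ('a \<times> 'b \<Rightarrow> real) \<Rightarrow> 'b \<Rightarrow> real" where
  "marginal D \<rho> y = (LINT x:D|lborel. \<rho> (x, y))"

definition X_space ::
  "'a::euclidean_space set \<Rightarrow> 'b::euclidean_space set \<Rightarrow> real \<Rightarrow> ('a \<times> 'b \<Rightarrow> real) set" where
  "X_space D E \<delta> = {\<rho> \<in> C_ac (D \<times> E). (INF y\<in>E. marginal D \<rho> y) \<ge> \<delta>}"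

definition kernel_cond ::
  "'a::euclidean_space set \<Rightarrow> ('a \<times> 'b \<Rightarrow> real) \<Rightarrow> 'a \<times> 'b \<Rightarrow> real" where
  "kernel_cond D \<rho> = (\<lambda>(x, y). \<rho> (x, y) / marginal D \<rho> y)"

lemma marginal_ge:
  fixes D :: "'a::euclidean_space set" and E :: "'b::euclidean_space set"
  assumes "\<rho> \<in> X_space D E \<delta>" "y \<in> E"
  shows "\<delta> \<le> marginal D \<rho> y"
proof -
  have nn: "0 \<le> marginal D \<rho> y'" if "y' \<in> E" for y'
    unfolding marginal_def set_lebesgue_integral_def
    using assms(1) that
    by (intro Bochner_Integration.integral_nonneg)
       (auto simp: X_space_def C_ac_def indicator_def)
  have "(INF y\<in>E. marginal D \<rho> y) \<le> marginal D \<rho> y"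
    using assms(2) nn by (intro cINF_lower bdd_belowI2[of _ 0]) auto
  then show ?thesis
    using assms(1) by (auto simp: X_space_def)
qed

lemma continuous_on_marginal:
  fixes D :: "'a::euclidean_space set" and E :: "'b::euclidean_space set"
  assumes D: "compact D" and E: "compact E" and c: "continuous_on (D \<times> E) \<rho>"
  shows "continuous_on E (marginal D \<rho>)"
  unfolding continuous_on_iff
proof (intro ballI allI impI)
  fix y and e :: real
  assume y: "y \<in> E" and e: "e > 0"
  have int: "integrable lborel (\<lambda>x. indicator D x *\<^sub>R \<rho> (x, y'))" if "y' \<in> E" for y'
    using that
    by (intro borel_integrable_compact D continuous_on_compose2[OF c] continuous_intros) auto
  define M where "M = measure lborel D + 1"
  have M: "M > 0" unfolding M_def by (simp add: add_nonneg_pos)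
  have fin: "emeasure lborel D < \<infinity>"
    using D by (intro emeasure_bounded_finite compact_imp_bounded)
  have Ds: "D \<in> sets lborel" using D by (simp add: borel_compact)
  have "uniformly_continuous_on (D \<times> E) \<rho>"
    using c D E by (intro compact_uniformly_continuous compact_Times)
  then obtain d where d: "d > 0"
    "\<And>z z'. z \<in> D \<times> E \<Longrightarrow> z' \<in> D \<times> E \<Longrightarrow> dist z' z < d \<Longrightarrow> dist (\<rho> z') (\<rho> z) < e / M"
    using e M unfolding uniformly_continuous_on_def by (metis divide_pos_pos)
  show "\<exists>d>0. \<forall>y'\<in>E. dist y' y < d \<longrightarrow> dist (marginal D \<rho> y') (marginal D \<rho> y) < e"
  proof (intro exI[of _ d] conjI ballI impI d(1))
    fix y' assume y': "y' \<in> E" "dist y' y < d"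
    have "\<bar>marginal D \<rho> y' - marginal D \<rho> y\<bar>
        = \<bar>\<integral>x. indicator D x *\<^sub>R \<rho> (x, y') - indicator D x *\<^sub>R \<rho> (x, y) \<partial>lborel\<bar>"
      unfolding marginal_def set_lebesgue_integral_def
      using int y y' by (simp add: Bochner_Integration.integral_diff)
    also have "\<dots> \<le> (\<integral>x. \<bar>indicator D x *\<^sub>R \<rho> (x, y') - indicator D x *\<^sub>R \<rho> (x, y)\<bar> \<partial>lborel)"
      by (rule integral_abs_bound)
    also have "\<dots> \<le> (\<integral>x. indicator D x * (e / M) \<partial>lborel)"
    proof (rule integral_mono)
      show "integrable lborel
          (\<lambda>x. \<bar>indicator D x *\<^sub>R \<rho> (x, y') - indicator D x *\<^sub>R \<rho> (x, y)\<bar>)"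
        using int y y' by (intro integrable_abs Bochner_Integration.integrable_diff) auto
      show "integrable lborel (\<lambda>x. indicator D x * (e / M))"
        using fin Ds by (intro integrable_mult_left) auto
      show "\<bar>indicator D x *\<^sub>R \<rho> (x, y') - indicator D x *\<^sub>R \<rho> (x, y)\<bar>
          \<le> indicator D x * (e / M)" for x
        using d(2)[of "(x, y)" "(x, y')"] y y'
        by (auto simp: indicator_def dist_Pair_Pair dist_real_def)
    qed
    also have "\<dots> = measure lborel D * (e / M)"
      by simp
    also have "\<dots> < M * (e / M)"
      using e M by (intro mult_strict_right_mono) (auto simp: M_def)
    also have "\<dots> = e" using M by simp
    finally show "dist (marginal D \<rho> y') (marginal D \<rho> y) < e"
      by (simp add: dist_real_def)
  qed
qed

(* The operator maps into C(D \<times> E), so the suprema defining its norms are finite. *)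
lemma continuous_on_kernel_cond:
  fixes D :: "'a::euclidean_space set" and E :: "'b::euclidean_space set"
  assumes "compact D" "compact E" "\<delta> > 0" "\<rho> \<in> X_space D E \<delta>"
  shows "continuous_on (D \<times> E) (kernel_cond D \<rho>)"
proof -
  have c: "continuous_on (D \<times> E) \<rho>"
    using assms(4) by (auto simp: X_space_def C_ac_def)
  have "continuous_on (D \<times> E) (\<lambda>z. \<rho> z / marginal D \<rho> (snd z))"
    using assms(3) marginal_ge[OF assms(4)]
    by (intro continuous_on_divide c continuous_on_snd continuous_on_id
          continuous_on_compose2[OF continuous_on_marginal[OF assms(1,2) c]])
       force+
  then show ?thesis
    by (simp add: kernel_cond_def case_prod_unfold)
qed

end

(* Split
     p/m_p - q/m_q = (p - q)/m_p + q (m_q - m_p)/(m_p m_q),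
   where m_p, m_q \<ge> \<delta> and |m_q - m_p| \<le> |D| ||p - q||. This gives the bound with ||q|| in place
   of the minimum; exchanging p and q gives the one with ||p||. *)
theory Submission
  imports Defs
begin

text \<open>A real \<open>SUP\<close> is an upper bound only when the range is bounded above;
  compactness of the image of \<open>K\<close> under \<open>\<bar>f z\<bar>\<close> supplies
  this.\<close>

lemma abs_le_sup_norm_on:
  assumes "compact K" "continuous_on K f" "z \<in> K"
  shows "\<bar>f z\<bar> \<le> sup_norm_on K f"
proof -
  have "compact ((\<lambda>z. \<bar>f z\<bar>) ` K)"
    using assms by (intro compact_continuous_image continuous_intros)
  then show ?thesis
    unfolding sup_norm_on_def using assms(3)
    by (intro cSUP_upper bounded_imp_bdd_above compact_imp_bounded)
qed

lemma sup_norm_on_le: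
  assumes "K \<noteq> {}" "\<And>z. z \<in> K \<Longrightarrow> \<bar>f z\<bar> \<le> C"
  shows "sup_norm_on K f \<le> C"
  unfolding sup_norm_on_def using assms by (rule cSUP_least)

lemma sup_norm_on_minus_commute:
  "sup_norm_on K (\<lambda>z. f z - g z) = sup_norm_on K (\<lambda>z. g z - f z)"
  by (simp add: sup_norm_on_def abs_minus_commute)

text \<open>An integral over the empty set is 0, not 1. Hence the existence of a density in
  \<open>X_space D E \<delta>\<close> forces \<open>D \<times> E\<close> to be nonempty, as
  \<open>sup_norm_on_le\<close> requires.\<close>

lemma C_ac_empty [simp]: "C_ac {} = {}"
  by (simp add: C_ac_def set_lebesgue_integral_def)

text \<open>Integrate the uniform bound on \<open>f - g\<close> along the section at height
  \<open>y\<close>; the compact set \<open>D\<close> has finite measure.\<close>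

lemma abs_marginal_diff_le:
  fixes D :: "'a::euclidean_space set" and E :: "'b::euclidean_space set"
  assumes D: "compact D" and E: "compact E"
    and f: "continuous_on (D \<times> E) f" and g: "continuous_on (D \<times> E) g" and y: "y \<in> E"
  shows "\<bar>marginal D f y - marginal D g y\<bar>
    \<le> measure lborel D * sup_norm_on (D \<times> E) (\<lambda>z. f z - g z)"
    (is "_ \<le> _ * ?N")
proof -
  \<comment> \<open>Sections are continuous on the compact set \<open>D\<close>. Their integrability
    is what lets the difference of the two marginals become a single integral.\<close>
  have int: "set_integrable lborel D (\<lambda>x. h (x, y))" if "continuous_on (D \<times> E) h" for h :: "_ \<Rightarrow> real"
    unfolding set_integrable_def using y
    by (intro borel_integrable_compact D continuous_on_compose2[OF that] continuous_intros) auto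
  have fin: "emeasure lborel D < \<infinity>"
    using D by (intro emeasure_bounded_finite compact_imp_bounded)
  have bound: "\<bar>f (x, y) - g (x, y)\<bar> \<le> ?N" if "x \<in> D" for x
    using abs_le_sup_norm_on[OF compact_Times[OF D E] continuous_on_diff[OF f g], of "(x, y)"]
      that y by simp
  have "\<bar>marginal D f y - marginal D g y\<bar> = \<bar>LINT x:D|lborel. f (x, y) - g (x, y)\<bar>"
    unfolding marginal_def by (simp add: set_integral_diff int f g)
  also have "\<dots> \<le> (\<integral>x. \<bar>indicator D x *\<^sub>R (f (x, y) - g (x, y))\<bar> \<partial>lborel)"
    unfolding set_lebesgue_integral_def by (rule integral_abs_bound)
  also have "\<dots> \<le> (\<integral>x. indicator D x * ?N \<partial>lborel)"
  proof (rule integral_mono)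
    show "integrable lborel (\<lambda>x. \<bar>indicator D x *\<^sub>R (f (x, y) - g (x, y))\<bar>)"
      using set_integral_diff(1)[OF int[OF f] int[OF g]]
      unfolding set_integrable_def by (rule integrable_abs)
    show "integrable lborel (\<lambda>x. indicator D x * ?N)"
      using fin D by (intro integrable_mult_left) (auto simp: borel_compact)
    show "\<bar>indicator D x *\<^sub>R (f (x, y) - g (x, y))\<bar> \<le> indicator D x * ?N" for x
      using bound[of x] by (auto simp: indicator_def)
  qed
  also have "\<dots> = measure lborel D * ?N"
    by simp
  finally show ?thesis .
qed

text \<open>The pointwise estimate, freed of integrals: \<open>a\<close>, \<open>b\<close> stand for
  the values of p and q at a point, \<open>s\<close>, \<open>t\<close> for their marginals,
  \<open>B\<close> for the norm of q, \<open>M\<close> for |D| and \<open>N\<close> for the norm of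
  p - q.\<close>

lemma abs_divide_diff_le:
  fixes a b s t \<delta> B M N :: real
  assumes \<delta>: "0 < \<delta>" "\<delta> \<le> s" "\<delta> \<le> t"
    and b: "\<bar>b\<bar> \<le> B" and ab: "\<bar>a - b\<bar> \<le> N" and st: "\<bar>s - t\<bar> \<le> M * N"
  shows "\<bar>a / s - b / t\<bar> \<le> 1 / \<delta> * (1 + M * B / \<delta>) * N"
proof -
  \<comment> \<open>Adding and subtracting \<open>b / s\<close> leaves only \<open>b\<close> as a
    factor of the marginal difference, so no bound on \<open>a\<close> enters.\<close>
  have "a / s - b / t = (a - b) / s + b * (t - s) / (s * t)"
    using \<delta> by (simp add: field_simps)
  then have "\<bar>a / s - b / t\<bar> \<le> \<bar>a - b\<bar> / s + \<bar>b\<bar> * \<bar>s - t\<bar> / (s * t)"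
    using \<delta> abs_triangle_ineq[of "(a - b) / s" "b * (t - s) / (s * t)"]
    by (simp add: abs_mult abs_minus_commute)
  \<comment> \<open>Monotonicity needs \<open>B\<close>, \<open>N\<close> and \<open>M * N\<close>
    to be nonnegative; each of them dominates an absolute value.\<close>
  also have "\<dots> \<le> N / \<delta> + B * (M * N) / (\<delta> * \<delta>)"
    using assms by (intro add_mono frac_le mult_mono) (auto intro: order_trans[OF abs_ge_zero])
  also have "\<dots> = 1 / \<delta> * (1 + M * B / \<delta>) * N"
    using \<delta> by (simp add: field_simps)
  finally show ?thesis .
qed

lemma sup_norm_on_kernel_cond_diff_le:
  fixes D :: "'a::euclidean_space set" and E :: "'b::euclidean_space set"
  assumes D: "compact D" and E: "compact E" and \<delta>: "\<delta> > 0"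
    and p: "p \<in> X_space D E \<delta>" and q: "q \<in> X_space D E \<delta>"
  shows "sup_norm_on (D \<times> E) (\<lambda>z. kernel_cond D p z - kernel_cond D q z)
    \<le> 1 / \<delta> * (1 + measure lborel D * sup_norm_on (D \<times> E) q / \<delta>)
      * sup_norm_on (D \<times> E) (\<lambda>z. p z - q z)"
proof (rule sup_norm_on_le)
  show "D \<times> E \<noteq> {}"
    using p by (auto simp: X_space_def)
  have cp: "continuous_on (D \<times> E) p" and cq: "continuous_on (D \<times> E) q"
    using p q by (auto simp: X_space_def C_ac_def)
  note K = compact_Times[OF D E]
  fix z assume z: "z \<in> D \<times> E"
  then obtain x y where xy: "z = (x, y)" "y \<in> E" by auto
  show "\<bar>kernel_cond D p z - kernel_cond D q z\<bar>
    \<le> 1 / \<delta> * (1 + measure lborel D * sup_norm_on (D \<times> E) q / \<delta>)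
      * sup_norm_on (D \<times> E) (\<lambda>z. p z - q z)"
    using abs_divide_diff_le[OF \<delta> marginal_ge[OF p xy(2)] marginal_ge[OF q xy(2)]
        abs_le_sup_norm_on[OF K cq z]
        abs_le_sup_norm_on[OF K continuous_on_diff[OF cp cq] z]
        abs_marginal_diff_le[OF D E cp cq xy(2)]]
    by (simp add: kernel_cond_def xy(1))
qed

theorem lemma4p1:
  fixes D :: "(real ^ 'm) set" and E :: "(real ^ 'r) set" and \<delta> :: real
    and p q :: "(real ^ 'm) \<times> (real ^ 'r) \<Rightarrow> real"
  assumes "compact D" and "lipschitz_boundary D"
    and "compact E" and "lipschitz_boundary E"
    and "\<delta> > 0"
    and "p \<in> X_space D E \<delta>" and "q \<in> X_space D E \<delta>"
  shows "sup_norm_on (D \<times> E) (\<lambda>z. kernel_cond D p z - kernel_cond D q z)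
    \<le> 1 / \<delta> * (1 + measure lborel D * min (sup_norm_on (D \<times> E) p) (sup_norm_on (D \<times> E) q) / \<delta>)
      * sup_norm_on (D \<times> E) (\<lambda>z. p z - q z)"
  \<comment> \<open>Whichever norm attains the minimum, one of the two instances is the claim, once
    the symmetry of the norm of a difference turns the exchanged instance back.\<close>
  using sup_norm_on_kernel_cond_diff_le[OF assms(1,3,5,6,7)]
    sup_norm_on_kernel_cond_diff_le[OF assms(1,3,5,7,6)]
  by (simp add: min_def sup_norm_on_minus_commute[of _ q p]
      sup_norm_on_minus_commute[of _ "kernel_cond D q" "kernel_cond D p"])

end
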